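(* The equation $1+\frac{1}{p}\ln\left(\cos\frac{p\pi}{2}\right)=0$ has a unique root $p_1$ in $(0,1)$ (numerically $p_1\approx 0.6505$), and the following hold. (a) For all $t\in(0,\pi/2)$, $$\left(\cos\tfrac{2t}{3}\right)^{3/2}<e^{t\cot t-1}<\left(\cos p_1t\right)^{1/p_1},$$ and the constants $2/3$ and $p_1$ are best possible: for $p\in(0,1)$, if $(\cos pt)^{1/p}<e^{t\cot t-1}$ for all $t\in(0,\pi/2)$ then $p\ge 2/3$; and if $e^{t\cot t-1}<(\cos pt)^{1/p}$ for all $t\in(0,\pi/2)$ then $p\le p_1$. (b) For all $t\in(0,\pi/2)$, $$\left(\cos\tfrac{2t}{3}\right)^{3/2}<e^{t\cot t-1}<\left(\cos\tfrac{2t}{3}\right)^{1/\ln 2}<\frac{2\sqrt2}{e}\left(\cos\tfrac{2t}{3}\right)^{3/2},$$ and the exponents $3/2$ and $1/\ln 2$ in the first two inequalities are best possible: if $\left(\cos\frac{2t}{3}\right)^{r}<e^{t\cot t-1}$ for all $t\in(0,\pi/2)$ then $r\ge 3/2$, and if $e^{t\cot t-1}<\left(\cos\frac{2t}{3}\right)^{s}$ for all $t\in(0,\pi/2)$ then $s\le 1/\ln 2$. (c) For all $t\in(0,\pi/2)$, $$\left(\cos p_1t\right)^{2/(3p_1^2)}<e^{t\cot t-1}<\left(\cos p_1t\right)^{1/p_1},$$ where the constant $p_1$ in the right-hand inequality is best possible in the sense of (a). *)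

theory Defs
  imports Complex_Main
begin

end

theory Submission
  imports Defs "HOL-Complex_Analysis.Complex_Analysis" "HOL-Real_Asymp.Real_Asymp"
begin

text \<open>
  All inequalities compare \<open>F t = - ln (cos (p * t))\<close> with \<open>G t = 1 - t * cot t\<close>.
  If \<open>a\<^sub>n \<ge> 0\<close> are the Maclaurin coefficients of \<open>tan\<close>, integration gives
  \<open>F t = (\<Sum>n. a\<^sub>n p^(n+1) / (n+1) t^(n+1))\<close>, and the identity
  \<open>u * cot u - 2 * u * cot (2 * u) = u * tan u\<close> gives
  \<open>G t = (\<Sum>n. a\<^sub>n / (2^(n+1) - 1) t^(n+1))\<close>.
  For \<open>n \<ge> 1\<close> and \<open>p > 9/14\<close> the quotients of these coefficients increase with \<open>n\<close>, so
  \<open>F / G\<close> increases strictly from \<open>3 p\<^sup>2 / 2\<close> at \<open>0\<close> to \<open>- ln (cos (p * pi / 2))\<close>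
  at \<open>pi / 2\<close>. Both \<open>2/3\<close> and \<open>p\<^sub>1\<close> lie above \<open>9/14\<close>, and by definition the second limit is
  \<open>p\<^sub>1\<close> for \<open>p = p\<^sub>1\<close>.
\<close>

section \<open>Maclaurin coefficients of the tangent\<close>

text \<open>The complex series is taken because \<open>tan_sums\<close> relies on its convergence
  radius; by \<open>of_real_tan_coeff\<close> nothing is lost under \<open>Re\<close>.\<close>

definition tan_coeff :: "nat \<Rightarrow> real" where
  "tan_coeff n = Re (fps_nth (fps_tan 1) n)"

text \<open>Both sides become 1 after multiplication by \<open>(fps_cos 1)\<^sup>2\<close>.
  Comparing coefficients in this differential equation gives the recurrence below.\<close>

lemma fps_deriv_tan_1:
  "fps_deriv (fps_tan 1) = 1 + (fps_tan (1::'a::field_char_0))\<^sup>2"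
proof -
  have c0: "fps_cos (1::'a) $ 0 \<noteq> 0" by (simp add: fps_cos_def)
  hence c: "fps_cos (1::'a) \<noteq> 0" by (intro notI) simp
  have "(fps_tan (1::'a))\<^sup>2 * (fps_cos 1)\<^sup>2 = (fps_tan 1 * fps_cos 1)\<^sup>2"
    by (simp add: power_mult_distrib)
  also have "fps_tan 1 * fps_cos 1 = fps_sin (1::'a)"
    using c0 by (simp add: fps_tan_def fps_divide_unit mult.assoc inverse_mult_eq_1)
  finally have "(1 + (fps_tan (1::'a))\<^sup>2) * (fps_cos 1)\<^sup>2 = 1"
    using fps_sin_cos_sum_of_squares[of "1::'a"] by (simp add: algebra_simps)
  moreover have "fps_deriv (fps_tan (1::'a)) * (fps_cos 1)\<^sup>2 = 1"
    using c0 by (simp add: fps_tan_deriv fps_divide_unit inverse_mult_eq_1)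
  ultimately have "fps_deriv (fps_tan (1::'a)) * (fps_cos 1)\<^sup>2 = (1 + (fps_tan 1)\<^sup>2) * (fps_cos 1)\<^sup>2"
    by simp
  thus ?thesis using c by (subst (asm) mult_right_cancel) simp_all
qed

lemma fps_tan_nth_Suc:
  "of_nat (Suc n) * fps_nth (fps_tan (1::'a::field_char_0)) (Suc n) =
     (if n = 0 then 1 else 0) + (\<Sum>i\<le>n. fps_nth (fps_tan 1) i * fps_nth (fps_tan 1) (n - i))"
  using arg_cong[OF fps_deriv_tan_1[where 'a='a], of "\<lambda>f. fps_nth f n"]
  by (simp add: power2_eq_square fps_mult_nth atLeast0AtMost)

lemma fps_tan_nth_0: "fps_nth (fps_tan (1::'a::field_char_0)) 0 = 0"
  by (simp add: fps_tan_def fps_divide_unit fps_sin_def fps_cos_def)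

text \<open>Strong induction works because the recurrence contains no subtraction, only sums of
  products of earlier coefficients.\<close>

lemma fps_tan_nth_nonneg_Reals:
  "fps_nth (fps_tan (1::complex)) n \<in> \<real> \<and> Re (fps_nth (fps_tan 1) n) \<ge> 0"
proof (induction n rule: less_induct)
  case (less n)
  show ?case
  proof (cases n)
    case 0
    thus ?thesis by (simp add: fps_tan_nth_0)
  next
    case (Suc m)
    let ?T = "fps_nth (fps_tan (1::complex))"
    define s where "s = (if m = 0 then 1 else 0) + (\<Sum>i\<le>m. Re (?T i) * Re (?T (m - i)))"
    have T: "?T i = of_real (Re (?T i))" "Re (?T i) \<ge> 0" if "i \<le> m" for i
      using less.IH[of i] that Suc by (auto simp: of_real_Re)
    have "of_nat (Suc m) * ?T (Suc m) = of_real s"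
      unfolding fps_tan_nth_Suc s_def using T(1)
      by (auto intro!: sum.cong)
    hence "?T n = of_real (s / real (Suc m))"
      using Suc by (simp add: field_simps del: of_nat_Suc)
    moreover have "s \<ge> 0"
      unfolding s_def by (auto intro!: add_nonneg_nonneg sum_nonneg mult_nonneg_nonneg T)
    ultimately show ?thesis by simp
  qed
qed

lemma tan_coeff_nonneg: "tan_coeff n \<ge> 0"
  using fps_tan_nth_nonneg_Reals by (simp add: tan_coeff_def)

lemma of_real_tan_coeff: "of_real (tan_coeff n) = fps_nth (fps_tan (1::complex)) n"
  using fps_tan_nth_nonneg_Reals by (simp add: tan_coeff_def of_real_Re)

lemma tan_coeff_0: "tan_coeff 0 = 0"
  by (simp add: tan_coeff_def fps_tan_nth_0)

lemma tan_coeff_Suc: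
  "real (Suc n) * tan_coeff (Suc n) =
     (if n = 0 then 1 else 0) + (\<Sum>i\<le>n. tan_coeff i * tan_coeff (n - i))"
proof -
  have "complex_of_real (real (Suc n) * tan_coeff (Suc n)) =
     of_real ((if n = 0 then 1 else 0) + (\<Sum>i\<le>n. tan_coeff i * tan_coeff (n - i)))"
    using fps_tan_nth_Suc[of n, where 'a=complex] by (simp add: of_real_tan_coeff)
  thus ?thesis by (simp only: of_real_eq_iff)
qed

lemma tan_coeff_1: "tan_coeff 1 = 1"
  using tan_coeff_Suc[of 0] by (simp add: tan_coeff_0)

text \<open>A second positive coefficient besides index 1, needed for the strict bound in
  \<open>power_series_quotient_lower\<close>.\<close>

lemma tan_coeff_3_pos: "tan_coeff 3 > 0"
  using tan_coeff_Suc[of 2] tan_coeff_1 by (simp add: tan_coeff_0 numeral_2_eq_2 numeral_3_eq_3)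

text \<open>The complex series has convergence radius at least \<open>pi / 2\<close>; it is
  evaluated at a real point and read back in the reals.\<close>

lemma tan_sums:
  assumes "\<bar>x\<bar> < pi / 2"
  shows "(\<lambda>n. tan_coeff n * x ^ n) sums tan x"
proof -
  have n: "norm (complex_of_real x) < pi / (2 * norm (1::complex))" using assms by simp
  hence "ereal (norm (complex_of_real x)) < fps_conv_radius (fps_tan (1::complex))"
    using less_le_trans[OF _ fps_conv_radius_tan[of "1::complex"], of "ereal (norm (complex_of_real x))"] by simp
  hence "(\<lambda>n. fps_nth (fps_tan 1) n * complex_of_real x ^ n) sums eval_fps (fps_tan 1) (of_real x)"
    by (rule sums_eval_fps)
  also have "eval_fps (fps_tan 1) (of_real x) = complex_of_real (tan x)"
    using eval_fps_tan[OF n] by (simp add: tan_of_real)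
  finally have "(\<lambda>n. complex_of_real (tan_coeff n * x ^ n)) sums of_real (tan x)"
    by (simp add: of_real_tan_coeff)
  thus ?thesis by (simp only: sums_of_real_iff)
qed

text \<open>Termwise integration: the integrated series and \<open>- ln (cos x)\<close> have the
  same derivative \<open>tan x\<close> and agree at 0.\<close>

lemma ln_cos_sums:
  assumes "\<bar>x\<bar> < pi / 2"
  shows "(\<lambda>n. tan_coeff n / real (Suc n) * x ^ Suc n) sums (- ln (cos x))"
proof -
  \<comment> \<open>Integration shifts the index by one; the value 0 at index 0 fixes the constant
    of integration.\<close>
  define c where "c n = (case n of 0 \<Rightarrow> 0 | Suc m \<Rightarrow> tan_coeff m / real (Suc m))" for n
  have dc: "diffs c = tan_coeff"
    by (auto simp: diffs_def c_def fun_eq_iff simp del: of_nat_Suc)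
  have sm: "summable (\<lambda>n. c n * y ^ n)" if "norm y < pi / 2" for y
  proof -
    \<comment> \<open>The nonnegative tangent series at \<open>\<bar>y\<bar>\<close> dominates,
      since division by \<open>Suc n\<close> only shrinks terms.\<close>
    have "summable (\<lambda>n. norm (tan_coeff n * \<bar>y\<bar> ^ n))"
      using sums_summable[OF tan_sums[of "\<bar>y\<bar>"]] that tan_coeff_nonneg by (simp add: abs_mult)
    hence "summable (\<lambda>n. \<bar>y\<bar> * norm (tan_coeff n * \<bar>y\<bar> ^ n))" by (rule summable_mult)
    hence "summable (\<lambda>n. c (Suc n) * y ^ Suc n)"
    proof (rule summable_comparison_test')
      fix n :: nat
      have "tan_coeff n * 1 \<le> tan_coeff n * real (Suc n)"
        by (rule mult_left_mono) (auto simp: tan_coeff_nonneg)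
      hence le: "tan_coeff n / real (Suc n) \<le> tan_coeff n"
        by (simp add: divide_le_eq del: of_nat_Suc)
      show "norm (c (Suc n) * y ^ Suc n) \<le> \<bar>y\<bar> * norm (tan_coeff n * \<bar>y\<bar> ^ n)"
        using mult_right_mono[OF le, of "\<bar>y\<bar> ^ Suc n"] tan_coeff_nonneg[of n]
        by (simp add: c_def abs_mult power_abs mult_ac del: of_nat_Suc)
    qed
    thus ?thesis by (subst (asm) summable_Suc_iff)
  qed
  define S where "S y = (\<Sum>n. c n * y ^ n)" for y
  have d: "((\<lambda>y. S y + ln (cos y)) has_real_derivative 0) (at y)" if "\<bar>y\<bar> < pi / 2" for y
  proof -
    have "(S has_real_derivative (\<Sum>n. diffs c n * y^n)) (at y)"
      unfolding S_def by (rule termdiffs_strong'[where K = "pi / 2", OF sm]) (use that in auto)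
    also have "(\<Sum>n. diffs c n * y^n) = tan y"
      using tan_sums[OF that] by (simp add: dc sums_iff)
    finally have "(S has_real_derivative tan y) (at y)" .
    moreover have "cos y > 0" using that by (intro cos_gt_zero_pi) auto
    ultimately show ?thesis
      by (auto intro!: derivative_eq_intros simp: tan_def)
  qed
  have "\<exists>k. \<forall>y\<in>{-pi/2<..<pi/2}. S y + ln (cos y) = k"
    by (rule has_field_derivative_zero_constant)
       (auto intro!: has_field_derivative_at_within d)
  then obtain k where *: "\<forall>y\<in>{-pi/2<..<pi/2}. S y + ln (cos y) = k"
    by blast
  have k: "S y + ln (cos y) = k" if "\<bar>y\<bar> < pi / 2" for y
    using that by (intro bspec[OF *]) (auto simp: abs_less_iff)
  have "S 0 = 0" unfolding S_def by (subst suminf_finite[of "{0}"]) (auto simp: c_def)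
  hence "S x = - ln (cos x)" using k[of 0] k[of x] assms by simp
  hence "(\<lambda>n. c n * x ^ n) sums (- ln (cos x))"
    using sm[of x] assms unfolding S_def by (simp add: sums_iff)
  hence "(\<lambda>n. c (Suc n) * x ^ Suc n) sums (- ln (cos x))"
    by (subst sums_Suc_iff) (simp add: c_def)
  thus ?thesis by (simp add: c_def)
qed

section \<open>Power series of \<open>1 - t * cot t\<close>\<close>

text \<open>Multiplied by \<open>u\<close>, this says that passing from \<open>u\<close> to
  \<open>2 * u\<close> raises \<open>1 - u * cot u\<close> by \<open>u * tan u\<close>.\<close>

lemma double_cot:
  fixes u :: real
  assumes "sin u \<noteq> 0" "cos u \<noteq> 0"
  shows "2 * cot (2 * u) = cot u - tan u"
  using assms by (simp add: cot_def tan_def cos_double sin_double divide_simps power2_eq_square)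

lemma x_cot_x_tendsto: "((\<lambda>t::real. 1 - t * cot t) \<longlongrightarrow> 0) (at_right 0)"
  unfolding cot_def by real_asymp

text \<open>The denominators are dictated by doubling: term \<open>n\<close> gains the factor
  \<open>2 ^ Suc n\<close>, so the increment of the series is exactly the series of
  \<open>v * tan v\<close>, as for the closed form.\<close>

lemma x_cot_x_sums:
  assumes "0 < t" "t < pi / 2"
  shows "(\<lambda>n. tan_coeff n / (2 ^ Suc n - 1) * t ^ Suc n) sums (1 - t * cot t)"
proof -
  define b where "b n = tan_coeff n / (2 ^ Suc n - 1)" for n
  have p2: "(2::real) ^ Suc n - 1 \<ge> 1" for n
    using one_le_power[of "2::real" n] by simp
  have b: "0 \<le> b n" "b n \<le> tan_coeff n" for n
  proof -
    show "0 \<le> b n" using tan_coeff_nonneg[of n] p2[of n] unfolding b_def by (intro divide_nonneg_nonneg) linarith+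
    have "tan_coeff n * 1 \<le> tan_coeff n * (2 ^ Suc n - 1)"
      by (rule mult_left_mono[OF p2 tan_coeff_nonneg])
    thus "b n \<le> tan_coeff n" using p2[of n] by (simp add: b_def divide_le_eq del: power_Suc)
  qed
  have tan': "(\<lambda>n. tan_coeff n * u ^ Suc n) sums (u * tan u)" if "0 < u" "u < pi / 2" for u
    using sums_mult[OF tan_sums[of u], of u] that by (simp add: mult_ac)
  have sm: "summable (\<lambda>n. b n * u ^ Suc n)" if "0 < u" "u < pi / 2" for u
    by (rule summable_comparison_test'[OF sums_summable[OF tan'[OF that]], of 0])
       (use b that in \<open>auto simp: abs_mult intro!: mult_right_mono simp del: power_Suc\<close>)
  define S where "S u = (\<Sum>n. b n * u ^ Suc n)" for u
  define H where "H u = S u - (1 - u * cot u)" for u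
  have S_bounds: "0 \<le> S u" "S u \<le> u * tan u" if "0 < u" "u < pi / 2" for u
  proof -
    show "0 \<le> S u" unfolding S_def using b that
      by (intro suminf_nonneg sm) (auto simp del: power_Suc)
    have "S u \<le> (\<Sum>n. tan_coeff n * u ^ Suc n)" unfolding S_def using b that
      by (intro suminf_le sm sums_summable[OF tan'] mult_right_mono) auto
    thus "S u \<le> u * tan u" using tan'[OF that] by (simp add: sums_iff)
  qed
  have S_tendsto: "(S \<longlongrightarrow> 0) (at_right 0)"
  proof (rule tendsto_sandwich)
    show "\<forall>\<^sub>F u in at_right 0. 0 \<le> S u"
      using S_bounds by (auto simp: eventually_at_right[of 0 "pi/2"] intro!: exI[of _ "pi/2"])
    show "\<forall>\<^sub>F u in at_right 0. S u \<le> u * tan u"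
      using S_bounds by (auto simp: eventually_at_right[of 0 "pi/2"] intro!: exI[of _ "pi/2"])
    show "((\<lambda>u::real. u * tan u) \<longlongrightarrow> 0) (at_right 0)" by real_asymp
  qed simp
  have H_tendsto: "(H \<longlongrightarrow> 0) (at_right 0)"
    unfolding H_def using tendsto_diff[OF S_tendsto x_cot_x_tendsto] by simp
  have H_half: "H (u / 2) = H u" if u: "0 < u" "u < pi / 2" for u
  proof -
    define v where "v = u / 2"
    have v: "0 < v" "v < pi / 2" "u = 2 * v" using u by (auto simp: v_def)
    have "(\<lambda>n. b n * u ^ Suc n - b n * v ^ Suc n) sums (S u - S v)"
      unfolding S_def by (intro sums_diff summable_sums sm u v)
    also have "(\<lambda>n. b n * u ^ Suc n - b n * v ^ Suc n) = (\<lambda>n. tan_coeff n * v ^ Suc n)"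
    proof
      fix n
      have "b n * u ^ Suc n - b n * v ^ Suc n = b n * (2 ^ Suc n - 1) * v ^ Suc n"
        by (simp only: v(3) power_mult_distrib) (simp add: algebra_simps)
      thus "b n * u ^ Suc n - b n * v ^ Suc n = tan_coeff n * v ^ Suc n"
        using p2[of n] by (simp add: b_def del: power_Suc)
    qed
    finally have "S u - S v = v * tan v" using tan'[OF v(1,2)] sums_unique2 by blast
    moreover have "sin v > 0" "cos v > 0" using v by (auto intro!: sin_gt_zero cos_gt_zero)
    hence "u * cot u = v * cot v - v * tan v"
      using arg_cong[OF double_cot[of v], of "\<lambda>x. v * x"] v(3) by (simp add: algebra_simps)
    ultimately show ?thesis by (simp add: H_def v_def)
  qed
  \<comment> \<open>\<open>H\<close> is invariant under halving and tends to \<open>0\<close> at \<open>0\<close>, so it vanishes.\<close>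
  have H_pow: "H (t / 2 ^ n) = H t" for n
  proof (induction n)
    case (Suc n)
    have "t / 2 ^ n \<le> t" using assms by (simp add: divide_le_eq)
    hence "H (t / 2 ^ n / 2) = H (t / 2 ^ n)"
      using assms by (intro H_half le_less_trans[OF _ assms(2)]) auto
    with Suc show ?case by (simp add: mult.commute)
  qed simp
  have "filterlim (\<lambda>n. t / 2 ^ n) (at_right 0) sequentially"
    using assms by real_asymp
  from filterlim_compose[OF H_tendsto this] have "(\<lambda>n. H t) \<longlonglongrightarrow> 0" by (simp add: H_pow)
  hence "H t = 0" by (simp add: LIMSEQ_const_iff)
  thus ?thesis using sm[OF assms] by (simp add: H_def S_def b_def sums_iff)
qed

section \<open>Monotonicity of a quotient of power series\<close>

lemma sums_pos:
  fixes f :: "nat \<Rightarrow> real"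
  assumes "f sums s" "\<And>n. f n \<ge> 0" "f i > 0"
  shows "s > 0"
  using suminf_pos2[of f i] assms by (auto simp: sums_iff)

text \<open>Increasing coefficient quotients make the quotient of the sums increase. Writing the
  coefficients of \<open>F\<close> as \<open>b n * r n\<close> avoids dividing by a vanishing
  \<open>b n\<close>.\<close>

lemma power_series_quotient_increasing:
  fixes b r :: "nat \<Rightarrow> real" and F G :: "real \<Rightarrow> real"
  assumes b: "\<And>n. b n \<ge> 0" "b 0 = 0" "b 1 > 0" "b 3 > 0"
    and r: "\<And>m n. 1 \<le> m \<Longrightarrow> m < n \<Longrightarrow> r m < r n"
    and F: "\<And>t. 0 < t \<Longrightarrow> t < R \<Longrightarrow> (\<lambda>n. b n * r n * t ^ Suc n) sums F t"
    and G: "\<And>t. 0 < t \<Longrightarrow> t < R \<Longrightarrow> (\<lambda>n. b n * t ^ Suc n) sums G t"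
  shows power_series_quotient_pos: "0 < t \<Longrightarrow> t < R \<Longrightarrow> 0 < G t"
    and power_series_quotient_lower: "0 < t \<Longrightarrow> t < R \<Longrightarrow> r 1 * G t < F t"
    and power_series_quotient_less: "0 < t \<Longrightarrow> t < s \<Longrightarrow> s < R \<Longrightarrow> F t / G t < F s / G s"
proof -
  have pos: "0 < G t" if "0 < t" "t < R" for t
    by (rule sums_pos[OF G[OF that], of 1]) (use b that in auto)
  have D: "(\<lambda>n. b n * (r n - l) * t ^ Suc n) sums (F t - l * G t)" if "0 < t" "t < R" for t l
    using sums_diff[OF F[OF that] sums_mult[OF G[OF that], of l]] by (simp add: algebra_simps)
  have lower: "r 1 * G t < F t" if "0 < t" "t < R" for t
  proof -
    have "0 < F t - r 1 * G t"
    \<comment> \<open>The term at index 1 cancels, so strictness has to come from index 3.\<close>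
    proof (rule sums_pos[where i = 3, OF D[OF that]])
      show "b n * (r n - r 1) * t ^ Suc n \<ge> 0" for n
        using b(1,2) r[of 1 n] that by (cases "n = 0"; cases "n = 1") (auto simp: less_imp_le)
      show "b 3 * (r 3 - r 1) * t ^ Suc 3 > 0"
        using b(4) r[of 1 3] that by simp
    qed
    thus ?thesis by simp
  qed
  have less: "F t / G t < F s / G s" if t: "0 < t" "t < s" "s < R" for s t
  proof -
    have t': "0 < t" "t < R" and s': "0 < s" "s < R" using t by auto
    \<comment> \<open>With this \<open>l\<close>, the function \<open>F - l * G\<close> vanishes at
      \<open>t\<close>; the goal becomes its positivity at \<open>s\<close>.\<close>
    define l where "l = F t / G t"
    have l: "r 1 < l" "F t - l * G t = 0"
      using lower[OF t'] pos[OF t'] by (auto simp: l_def field_simps)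
    \<comment> \<open>Otherwise no term of \<open>F t - l * G t\<close> is positive and the one at
      index 1 is negative, so the sum could not be 0.\<close>
    have "\<exists>k\<ge>1. r k > l"
    proof (rule ccontr)
      assume "\<not> ?thesis"
      hence le: "r k \<le> l" if "k \<ge> 1" for k using that by force
      have "0 < - (F t - l * G t)"
      proof (rule sums_pos[where i = 1, OF sums_minus[OF D[OF t']]])
        show "- (b n * (r n - l) * t ^ Suc n) \<ge> 0" for n
        proof (cases "n = 0")
          case False
          have "b n * (r n - l) \<le> 0" using b(1) le[of n] False by (intro mult_nonneg_nonpos) auto
          thus ?thesis using mult_nonpos_nonneg[of "b n * (r n - l)" "t ^ Suc n"] t' by auto
        qed (use b in simp)
        show "- (b 1 * (r 1 - l) * t ^ Suc 1) > 0"
          using mult_neg_pos[OF mult_pos_neg[OF b(3), of "r 1 - l"], of "t ^ Suc 1"] l(1) t' by simp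
      qed
      with l(2) show False by simp
    qed
    define K where "K = (LEAST k. k \<ge> 1 \<and> r k > l)"
    have K: "K \<ge> 1" "r K > l"
      unfolding K_def using LeastI_ex[of "\<lambda>k. k \<ge> 1 \<and> r k > l"] \<open>\<exists>k\<ge>1. r k > l\<close> by auto
    \<comment> \<open>The coefficients of \<open>F - l * G\<close> change sign once, at \<open>K\<close>, so dividing by \<open>t ^ Suc K\<close>
      makes every term of the series nondecreasing in \<open>t\<close>.\<close>
    have below: "r n \<le> l" if "1 \<le> n" "n < K" for n
      using not_less_Least[of n "\<lambda>k. k \<ge> 1 \<and> r k > l"] that by (auto simp: K_def)
    have above: "l < r n" if "n \<ge> K" for n
      using K r[of K n] that by (cases "n = K") auto
    define q where "q = s / t"
    have q: "q > 1" "s = q * t" using t by (auto simp: q_def)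
    \<comment> \<open>The factor \<open>q ^ Suc K\<close> replaces dividing by
      \<open>s ^ Suc K\<close> at \<open>s\<close> and by \<open>t ^ Suc K\<close> at
      \<open>t\<close>.\<close>
    have "0 < (F s - l * G s) - q ^ Suc K * (F t - l * G t)"
    proof (rule sums_pos[where i = 1, OF sums_diff[OF D[OF s'] sums_mult[OF D[OF t']]]])
      have eq: "b n * (r n - l) * s ^ Suc n - q ^ Suc K * (b n * (r n - l) * t ^ Suc n) =
              b n * t ^ Suc n * ((r n - l) * (q ^ Suc n - q ^ Suc K))" for n
        by (simp add: q(2) power_mult_distrib algebra_simps)
      show "b n * (r n - l) * s ^ Suc n - q ^ Suc K * (b n * (r n - l) * t ^ Suc n) \<ge> 0" for n
      proof (cases "n = 0")
        case False
        have "(r n - l) * (q ^ Suc n - q ^ Suc K) \<ge> 0"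
        proof (cases "n < K")
          case True
          thus ?thesis using below[of n] False q(1)
            by (intro mult_nonpos_nonpos) (auto intro!: power_increasing simp del: power_Suc)
        next
          case False
          thus ?thesis using above[of n] q(1)
            by (intro mult_nonneg_nonneg) (auto intro!: power_increasing simp del: power_Suc)
        qed
        thus ?thesis unfolding eq using b(1)[of n] zero_le_power[of t "Suc n"] t'
          by (intro mult_nonneg_nonneg[of "b n * t ^ Suc n"]) (auto simp del: power_Suc)
      qed (use b in simp)
      \<comment> \<open>Index 1 lies strictly below the sign change, so its term grows
        strictly.\<close>
      have "1 < K" using K l(1) by (cases "K = 1") auto
      hence "q ^ Suc 1 < q ^ Suc K" using q(1) by (intro power_strict_increasing) auto
      hence "(r 1 - l) * (q ^ Suc 1 - q ^ Suc K) > 0" using l(1) by (intro mult_neg_neg) auto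
      thus "b 1 * (r 1 - l) * s ^ Suc 1 - q ^ Suc K * (b 1 * (r 1 - l) * t ^ Suc 1) > 0"
        unfolding eq using b(3) t'
        by (intro mult_pos_pos[of "b 1 * t ^ Suc 1"]) auto
    qed
    hence "l * G s < F s" using l(2) by simp
    thus ?thesis using pos[OF s'] by (simp add: l_def pos_less_divide_eq)
  qed
  show "0 < t \<Longrightarrow> t < R \<Longrightarrow> 0 < G t"
    and "0 < t \<Longrightarrow> t < R \<Longrightarrow> r 1 * G t < F t"
    and "0 < t \<Longrightarrow> t < s \<Longrightarrow> s < R \<Longrightarrow> F t / G t < F s / G s"
    using pos lower less by auto
qed

section \<open>Sign and numerical location of the root\<close>

text \<open>The function \<open>p + ln (cos (p * pi / 2))\<close> is strictly concave and vanishes at \<open>0\<close>.\<close>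

lemma root_sign_after:
  fixes p q :: real
  assumes "0 < p" "p < q" "q < 1" "p + ln (cos (p * pi / 2)) \<le> 0"
  shows "q + ln (cos (q * pi / 2)) < 0"
proof -
  define g where "g x = x + ln (cos (x * pi / 2))" for x :: real
  define g' where "g' x = 1 - pi / 2 * tan (x * pi / 2)" for x :: real
  have rng: "0 \<le> x * pi / 2 \<and> x * pi / 2 < pi / 2" if "0 \<le> x" "x < 1" for x
    using that by simp
  have d: "(g has_real_derivative g' x) (at x)" if "0 \<le> x" "x < 1" for x
  proof -
    have "cos (x * pi / 2) > 0" using rng[OF that] pi_gt_zero by (intro cos_gt_zero_pi) linarith+
    thus ?thesis unfolding g_def g'_def
      by (auto intro!: derivative_eq_intros simp: tan_def mult.commute)
  qed
  \<comment> \<open>The mean slope over \<open>[0, p]\<close> is at most 0, and \<open>g'\<close>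
    decreases strictly, so the mean slope over \<open>[p, q]\<close> is negative.\<close>
  obtain x where x: "0 < x" "x < p" "g p - g 0 = (p - 0) * g' x"
    using MVT2[of 0 p g g'] d assms by auto
  obtain y where y: "p < y" "y < q" "g q - g p = (q - p) * g' y"
    using MVT2[of p q g g'] d assms by auto
  have "g 0 = 0" "g p \<le> 0" using assms by (auto simp: g_def)
  hence "p * g' x \<le> 0" using x(3) by simp
  hence "g' x \<le> 0" using assms(1) by (simp add: mult_le_0_iff)
  moreover have "tan (x * pi / 2) < tan (y * pi / 2)"
  proof (rule tan_monotone)
    show "- (pi / 2) < x * pi / 2" using x(1) mult_pos_pos[OF x(1) pi_gt_zero] pi_gt_zero by linarith
    show "x * pi / 2 < y * pi / 2" using x(2) y(1) by simp
    show "y * pi / 2 < pi / 2" using y assms by simp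
  qed
  hence "g' y < g' x" unfolding g'_def by simp
  ultimately have "(q - p) * g' y < 0" using assms(2) by (intro mult_pos_neg) auto
  thus ?thesis using y(3) \<open>g p \<le> 0\<close> by (simp add: g_def)
qed

text \<open>Taylor polynomials separate \<open>exp (-0.6505)\<close> from the cosine, with 0.521799
  in between; \<open>y\<close> is \<open>0.6505 * pi / 2\<close> rounded up.\<close>

lemma root_lower: "0 < (0.6505::real) + ln (cos (0.6505 * pi / 2))"
proof -
  define y :: real where "y = 1.0218031"
  have x: "0 \<le> 0.6505 * pi / 2" "0.6505 * pi / 2 \<le> y"
    using pi_approx by (auto simp: y_def)
  have "cos y \<le> cos (0.6505 * pi / 2)"
    using x pi_gt3 by (intro cos_monotone_0_pi_le) (auto simp: y_def)
  moreover obtain t where t: "0 < t" "t < y"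
      "cos y = (\<Sum>m<8. cos_coeff m * y ^ m) + cos (t + 1/2 * real 8 * pi) / fact 8 * y ^ 8"
    using Maclaurin_cos_expansion2[of y 8] by (auto simp: y_def)
  \<comment> \<open>Order 8 shifts by two full periods, so the remainder is nonnegative and the
    polynomial is a lower bound.\<close>
  have "cos (t + 1/2 * real 8 * pi) = cos t"
    using cos_periodic[of t] cos_periodic[of "t + 2 * pi"] by (simp add: algebra_simps)
  moreover have "cos t \<ge> 0" using t pi_gt3 by (intro cos_ge_zero) (auto simp: y_def)
  ultimately have "cos (0.6505 * pi / 2) \<ge> (\<Sum>m<8. cos_coeff m * y ^ m)"
    using t(3) by (smt (verit) divide_nonneg_nonneg fact_ge_zero mult_nonneg_nonneg zero_le_even_power even_numeral)
  moreover have "(\<Sum>m<8. cos_coeff m * y ^ m) > 0.521799"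
    by (simp add: y_def cos_coeff_def lessThan_nat_numeral fact_numeral power_divide)
  moreover obtain u :: real where
      "exp (-0.6505) = (\<Sum>m<7. (-0.6505) ^ m / fact m) + exp u / fact 7 * (-0.6505) ^ 7"
    using Maclaurin_exp_le[of "-0.6505" 7] by blast
  \<comment> \<open>The odd order 7 makes the remainder negative.\<close>
  hence "exp (-0.6505::real) \<le> (\<Sum>m<7. (-0.6505) ^ m / fact m)" by simp
  moreover have "(\<Sum>m<7. (-0.6505::real) ^ m / fact m) < 0.521799"
    by (simp add: lessThan_nat_numeral fact_numeral power_divide)
  ultimately have "exp (-0.6505) < cos (0.6505 * pi / 2)" by linarith
  hence "-0.6505 < ln (cos (0.6505 * pi / 2))"
    by (metis exp_gt_zero exp_less_cancel_iff exp_ln less_trans)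
  thus ?thesis by simp
qed

text \<open>The mirror image of \<open>root_lower\<close>: \<open>y\<close> is rounded down, 0.5217
  separates, and the orders 10 and 8 reverse both remainder signs.\<close>

lemma root_upper: "(0.6506::real) + ln (cos (0.6506 * pi / 2)) < 0"
proof -
  define y :: real where "y = 1.02196"
  have x: "0.6506 * pi / 2 \<le> pi" "y \<le> 0.6506 * pi / 2"
    using pi_approx by (auto simp: y_def)
  have "cos (0.6506 * pi / 2) \<le> cos y"
    using x pi_gt3 by (intro cos_monotone_0_pi_le) (auto simp: y_def)
  moreover obtain t where t: "0 < t" "t < y"
      "cos y = (\<Sum>m<10. cos_coeff m * y ^ m) + cos (t + 1/2 * real 10 * pi) / fact 10 * y ^ 10"
    using Maclaurin_cos_expansion2[of y 10] by (auto simp: y_def)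
  have "cos (t + 1/2 * real 10 * pi) = - cos t"
    using cos_periodic[of "t + pi"] cos_periodic[of "t + 3 * pi"] by (simp add: algebra_simps)
  moreover have "cos t \<ge> 0" using t pi_gt3 by (intro cos_ge_zero) (auto simp: y_def)
  ultimately have "cos (0.6506 * pi / 2) \<le> (\<Sum>m<10. cos_coeff m * y ^ m)"
    using t(3) by (smt (verit) divide_nonneg_nonneg fact_ge_zero mult_nonneg_nonneg zero_le_even_power even_numeral minus_divide_left mult_minus_left)
  moreover have "(\<Sum>m<10. cos_coeff m * y ^ m) < 0.5217"
    by (simp add: y_def cos_coeff_def lessThan_nat_numeral fact_numeral power_divide)
  moreover obtain u :: real where
      "exp (-0.6506) = (\<Sum>m<8. (-0.6506) ^ m / fact m) + exp u / fact 8 * (-0.6506) ^ 8"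
    using Maclaurin_exp_le[of "-0.6506" 8] by blast
  hence "exp (-0.6506::real) \<ge> (\<Sum>m<8. (-0.6506) ^ m / fact m)" by simp
  moreover have "(\<Sum>m<8. (-0.6506::real) ^ m / fact m) > 0.5217"
    by (simp add: lessThan_nat_numeral fact_numeral power_divide)
  ultimately have "cos (0.6506 * pi / 2) < exp (-0.6506)" by linarith
  moreover have "cos (0.6506 * pi / 2) > 0" by (intro cos_gt_zero_pi) (auto simp: pi_gt_zero)
  ultimately have "ln (cos (0.6506 * pi / 2)) < -0.6506"
    by (metis exp_gt_zero ln_exp ln_less_cancel_iff)
  thus ?thesis by simp
qed

section \<open>Comparison of \<open>- ln (cos (p * t))\<close> with
  \<open>1 - t * cot t\<close>\<close>

text \<open>The step from \<open>k\<close> to \<open>k + 1\<close> needs \<open>p\<close> above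
  \<open>(k + 2) * (2 ^ (k + 1) - 1) / ((k + 1) * (2 ^ (k + 2) - 1))\<close>, which at
  \<open>k = 1\<close> equals 9/14 and never exceeds it later.\<close>

lemma coeff_ratio_increasing:
  fixes p :: real
  assumes "9 / 14 < p" "1 \<le> m" "m < n"
  shows "p ^ Suc m * (2 ^ Suc m - 1) / real (Suc m) < p ^ Suc n * (2 ^ Suc n - 1) / real (Suc n)"
proof -
  have step: "p ^ Suc k * (2 ^ Suc k - 1) / real (Suc k) <
              p ^ Suc (Suc k) * (2 ^ Suc (Suc k) - 1) / real (Suc (Suc k))" if "k \<ge> 1" for k
  proof -
    have a: "14 * (real k + 2) * (2 ^ Suc k - 1) \<le> 9 * (real k + 1) * (2 ^ Suc (Suc k) - 1)"
    proof (cases "k \<le> 2")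
      case True
      hence "k = 1 \<or> k = 2" using that by auto
      thus ?thesis by auto
    next
      case False
      \<comment> \<open>The factor \<open>8 * real k - 20\<close> is positive only from
        \<open>k = 3\<close> on, hence the separate check of 1 and 2.\<close>
      hence "0 \<le> (2::real) ^ k * (8 * real k - 20) + (5 * real k + 19)"
        by (intro add_nonneg_nonneg mult_nonneg_nonneg) auto
      also have "\<dots> = 9 * (real k + 1) * (2 ^ Suc (Suc k) - 1) - 14 * (real k + 2) * (2 ^ Suc k - 1)"
        by (simp add: algebra_simps)
      finally show ?thesis by simp
    qed
    have "9 * (real k + 1) * (2 ^ Suc (Suc k) - 1) < 14 * p * (real k + 1) * (2 ^ Suc (Suc k) - 1)"
    proof -
      have "(1::real) < 2 ^ Suc (Suc k)" by (rule one_less_power) auto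
      thus ?thesis using assms(1) by (intro mult_strict_right_mono) auto
    qed
    with a have "(real k + 2) * (2 ^ Suc k - 1) < p * (real k + 1) * (2 ^ Suc (Suc k) - 1)"
      by linarith
    hence "p ^ Suc k * ((real k + 2) * (2 ^ Suc k - 1)) <
           p ^ Suc k * (p * (real k + 1) * (2 ^ Suc (Suc k) - 1))"
      using assms(1) by (intro mult_strict_left_mono) auto
    thus ?thesis
      by (simp add: divide_less_eq less_divide_eq mult_ac add_ac del: power_Suc)
         (simp add: algebra_simps)
  qed
  show ?thesis
    using assms(3,2)
  proof (induction rule: less_Suc_induct)
    case (1 i)
    thus ?case by (rule step)
  next
    case (2 i j k)
    thus ?case by (meson less_imp_le less_trans order_trans)
  qed
qed

lemma cos_mult_pos:
  fixes p t :: real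
  assumes "0 < p" "p \<le> 1" "0 < t" "t < pi / 2"
  shows "0 < p * t" "p * t < pi / 2" "cos (p * t) > 0"
proof -
  show *: "0 < p * t" "p * t < pi / 2"
    using assms mult_right_mono[of p 1 t] mult_pos_pos[of p t] by linarith+
  show "cos (p * t) > 0" by (rule cos_gt_zero[OF *])
qed

lemma cos_mult_pi_half_pos:
  assumes "0 < p" "p < (1::real)"
  shows "cos (p * pi / 2) > 0"
  using assms by (intro cos_gt_zero) auto

text \<open>The lower constant is the first coefficient quotient \<open>r 1\<close>; the upper one
  is the limit of \<open>F / G\<close> at \<open>pi / 2\<close>, where \<open>G\<close> equals 1
  because \<open>cot (pi / 2) = 0\<close>.\<close>

lemma ln_cos_vs_x_cot_x:
  fixes p :: real
  assumes p: "9 / 14 < p" "p < 1" and t: "0 < t" "t < pi / 2"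
  shows x_cot_x_pos: "0 < 1 - t * cot t"
    and ln_cos_lower: "3 * p\<^sup>2 / 2 * (1 - t * cot t) < - ln (cos (p * t))"
    and ln_cos_upper: "- ln (cos (p * t)) < - ln (cos (p * pi / 2)) * (1 - t * cot t)"
proof -
  define b where "b n = tan_coeff n / (2 ^ Suc n - 1)" for n
  define r where "r n = p ^ Suc n * (2 ^ Suc n - 1) / real (Suc n)" for n
  define F where "F t = - ln (cos (p * t))" for t
  define G where "G t = 1 - t * cot t" for t :: real
  have p2: "(2::real) ^ Suc n - 1 > 0" for n
    using one_less_power[of "2::real" "Suc n"] by simp
  have b: "b n \<ge> 0" "b 0 = 0" "b 1 > 0" "b 3 > 0" for n
    using tan_coeff_nonneg[of n] p2[of n] tan_coeff_1 tan_coeff_3_pos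
    by (auto simp: b_def tan_coeff_0 simp del: power_Suc)
  have r: "r m < r n" if "1 \<le> m" "m < n" for m n
    unfolding r_def by (rule coeff_ratio_increasing[OF p(1) that])
  have F: "(\<lambda>n. b n * r n * t ^ Suc n) sums F t" if "0 < t" "t < pi / 2" for t
  proof -
    have "\<bar>p * t\<bar> < pi / 2" using cos_mult_pos[of p t] p that by auto
    from ln_cos_sums[OF this] show ?thesis unfolding F_def
    proof (rule sums_cong[THEN iffD1, rotated])
      fix n
      show "tan_coeff n / real (Suc n) * (p * t) ^ Suc n = b n * r n * t ^ Suc n"
        using less_imp_neq[OF p2[of n]]
        by (simp add: b_def r_def power_mult_distrib del: power_Suc of_nat_Suc)
    qed
  qed
  have G: "(\<lambda>n. b n * t ^ Suc n) sums G t" if "0 < t" "t < pi / 2" for t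
    unfolding b_def G_def by (rule x_cot_x_sums[OF that])
  have less: "F u / G u < F v / G v" if "0 < u" "u < v" "v < pi / 2" for u v
    by (rule power_series_quotient_less[of b r "pi / 2" F G]) (blast intro: b r F G that)+
  have "0 < G t"
    by (rule power_series_quotient_pos[of b r "pi / 2" F G]) (blast intro: b r F G t)+
  thus pos: "0 < 1 - t * cot t" by (simp add: G_def)
  have "r 1 * G t < F t"
    by (rule power_series_quotient_lower[of b r "pi / 2" F G]) (blast intro: b r F G t)+
  thus "3 * p\<^sup>2 / 2 * (1 - t * cot t) < - ln (cos (p * t))"
    by (simp add: G_def F_def r_def power2_eq_square mult_ac)
  \<comment> \<open>An intermediate point keeps the inequality strict after the passage to the
    limit.\<close>
  define s where "s = (t + pi / 2) / 2"
  have s: "t < s" "s < pi / 2" using t by (auto simp: s_def)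
  have lim: "((\<lambda>x. F x / G x) \<longlongrightarrow> F (pi / 2) / G (pi / 2)) (at_left (pi / 2))"
    unfolding F_def G_def using cos_mult_pi_half_pos[of p] p
    by (intro tendsto_intros) (auto simp: cot_def)
  have "F s / G s \<le> F (pi / 2) / G (pi / 2)"
  proof (rule tendsto_lowerbound[OF lim])
    have "F s / G s \<le> F x / G x" if "s < x" "x < pi / 2" for x
      using less[OF _ that] s t by simp
    thus "\<forall>\<^sub>F x in at_left (pi / 2). F s / G s \<le> F x / G x"
      using s by (auto simp: eventually_at_left[of s])
  qed simp
  moreover have "F t / G t < F s / G s"
    by (rule less[OF t(1) s])
  ultimately have "F t / G t < F (pi / 2)" by (simp add: G_def cot_def)
  thus "- ln (cos (p * t)) < - ln (cos (p * pi / 2)) * (1 - t * cot t)"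
    using pos by (simp only: F_def G_def pos_divide_less_eq times_divide_eq_right)
qed

section \<open>Logarithmic form and necessary conditions at the endpoints\<close>

lemma cos_powr_less_iff:
  fixes c q t :: real
  assumes "c > 0"
  shows "c powr q < exp (t * cot t - 1) \<longleftrightarrow> 1 - t * cot t < q * (- ln c)"
    and "exp (t * cot t - 1) < c powr q \<longleftrightarrow> q * (- ln c) < 1 - t * cot t"
  using assms by (auto simp: powr_def)

text \<open>Let \<open>t\<close> tend to 0 in the logarithmic quotient. The choices
  \<open>p = 2/3\<close> and \<open>q = 1 / p\<close> give the best constants 3/2 and 2/3.\<close>

lemma lower_exponent_bound:
  fixes p q :: real
  assumes p: "0 < p" "p < 1"
    and le: "\<And>t. 0 < t \<Longrightarrow> t < pi / 2 \<Longrightarrow> cos (p * t) powr q < exp (t * cot t - 1)"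
  shows "1 \<le> q * (3 * p\<^sup>2 / 2)"
proof -
  have "((\<lambda>t. q * (- ln (cos (p * t))) / (1 - t * cot t)) \<longlongrightarrow> q * (p * p) * 3 / 2) (at_right 0)"
    unfolding cot_def using p(1) by real_asymp
  hence "((\<lambda>t. q * (- ln (cos (p * t))) / (1 - t * cot t)) \<longlongrightarrow> q * (3 * p\<^sup>2 / 2)) (at_right 0)"
    by (simp add: power2_eq_square mult_ac)
  moreover have "1 \<le> q * (- ln (cos (p * t))) / (1 - t * cot t)" if t: "0 < t" "t < pi / 2" for t
  proof -
    have "1 - t * cot t < q * (- ln (cos (p * t)))"
      using le[OF t] cos_powr_less_iff(1)[OF cos_mult_pos(3), of p t] p t by simp
    \<comment> \<open>This positivity does not involve \<open>p\<close>, so 2/3 stands in as a value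
      above 9/14.\<close>
    moreover have "0 < 1 - t * cot t" using x_cot_x_pos[of "2/3" t] t by simp
    ultimately show ?thesis by (intro pos_le_divide_eq[THEN iffD2]) auto
  qed
  hence "\<forall>\<^sub>F t in at_right 0. 1 \<le> q * (- ln (cos (p * t))) / (1 - t * cot t)"
    by (auto simp: eventually_at_right[of 0 "pi / 2"] intro!: exI[of _ "pi / 2"])
  ultimately show ?thesis
    by (rule tendsto_lowerbound) simp
qed

text \<open>Let \<open>t\<close> tend to \<open>pi / 2\<close>, where \<open>1 - t * cot t\<close>
  tends to 1. For \<open>p = 2/3\<close> the cosine becomes 1/2, which is where \<open>ln 2\<close>
  comes from.\<close>

lemma upper_exponent_bound:
  fixes p q :: real
  assumes p: "0 < p" "p < 1"
    and le: "\<And>t. 0 < t \<Longrightarrow> t < pi / 2 \<Longrightarrow> exp (t * cot t - 1) < cos (p * t) powr q"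
  shows "q * (- ln (cos (p * pi / 2))) \<le> 1"
proof -
  have "((\<lambda>t. q * (- ln (cos (p * t))) - (1 - t * cot t)) \<longlongrightarrow>
          q * (- ln (cos (p * (pi / 2)))) - (1 - pi / 2 * cot (pi / 2))) (at_left (pi / 2))"
    using cos_mult_pi_half_pos[of p] p by (intro tendsto_intros) auto
  moreover have "q * (- ln (cos (p * t))) - (1 - t * cot t) \<le> 0" if t: "0 < t" "t < pi / 2" for t
    using le[OF t] cos_powr_less_iff(2)[OF cos_mult_pos(3), of p t] p t by simp
  hence "\<forall>\<^sub>F t in at_left (pi / 2). q * (- ln (cos (p * t))) - (1 - t * cot t) \<le> 0"
    by (auto simp: eventually_at_left[of 0] intro!: exI[of _ 0])
  ultimately have "q * (- ln (cos (p * (pi / 2)))) - (1 - pi / 2 * cot (pi / 2)) \<le> 0"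
    by (rule tendsto_upperbound) simp
  thus ?thesis by (simp add: cot_def)
qed

section \<open>The unique root and the assembled inequalities\<close>

lemma root_equation_iff:
  fixes p :: real
  assumes "p > 0"
  shows "1 + (1 / p) * ln (cos (p * pi / 2)) = 0 \<longleftrightarrow> p + ln (cos (p * pi / 2)) = 0"
  using assms by (simp add: field_simps)

text \<open>Existence by the intermediate value theorem between the two numerical bounds; uniqueness
  because the function stays negative after a root.\<close>

lemma ex1_root:
  "\<exists>!p::real. 0 < p \<and> p < 1 \<and> 1 + (1 / p) * ln (cos (p * pi / 2)) = 0"
proof -
  have "\<exists>p\<ge>0.6505. p \<le> 0.6506 \<and> (p::real) + ln (cos (p * pi / 2)) = 0"
  proof (rule IVT2)
    show "\<forall>x. 0.6505 \<le> x \<and> x \<le> (0.6506::real) \<longrightarrow> isCont (\<lambda>p. p + ln (cos (p * pi / 2))) x"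
    proof safe
      fix x :: real assume "0.6505 \<le> x" "x \<le> 0.6506"
      hence "cos (x * pi / 2) > 0" by (intro cos_mult_pi_half_pos) auto
      thus "isCont (\<lambda>p. p + ln (cos (p * pi / 2))) x" by (intro continuous_intros) auto
    qed
  qed (use root_lower root_upper in auto)
  then obtain p :: real where p: "0.6505 \<le> p" "p \<le> 0.6506" "p + ln (cos (p * pi / 2)) = 0"
    by blast
  show ?thesis
  proof (rule ex1I[of _ p])
    show "0 < p \<and> p < 1 \<and> 1 + (1 / p) * ln (cos (p * pi / 2)) = 0"
      using p root_equation_iff[of p] by simp
    fix q :: real
    assume q: "0 < q \<and> q < 1 \<and> 1 + (1 / q) * ln (cos (q * pi / 2)) = 0"
    hence "q + ln (cos (q * pi / 2)) = 0" using root_equation_iff[of q] by simp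
    thus "q = p"
      using root_sign_after[of p q] root_sign_after[of q p] p q by (cases p q rule: linorder_cases) auto
  qed
qed

theorem theorem1:
  shows "(\<exists>!p::real. 0 < p \<and> p < 1 \<and> 1 + (1 / p) * ln (cos (p * pi / 2)) = 0) \<and>
    (\<forall>p1::real. 0 < p1 \<and> p1 < 1 \<and> 1 + (1 / p1) * ln (cos (p1 * pi / 2)) = 0 \<longrightarrow>
      (0.6505 \<le> p1 \<and> p1 < 0.6506) \<and>
      ((\<forall>t::real. 0 < t \<and> t < pi / 2 \<longrightarrow>
          cos (2 * t / 3) powr (3 / 2) < exp (t * cot t - 1) \<and>
          exp (t * cot t - 1) < cos (p1 * t) powr (1 / p1)) \<and>
       (\<forall>p::real. 0 < p \<and> p < 1 \<longrightarrow>
          (\<forall>t::real. 0 < t \<and> t < pi / 2 \<longrightarrow>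
             cos (p * t) powr (1 / p) < exp (t * cot t - 1)) \<longrightarrow> p \<ge> 2 / 3) \<and>
       (\<forall>p::real. 0 < p \<and> p < 1 \<longrightarrow>
          (\<forall>t::real. 0 < t \<and> t < pi / 2 \<longrightarrow>
             exp (t * cot t - 1) < cos (p * t) powr (1 / p)) \<longrightarrow> p \<le> p1)) \<and>
      ((\<forall>t::real. 0 < t \<and> t < pi / 2 \<longrightarrow>
          cos (2 * t / 3) powr (3 / 2) < exp (t * cot t - 1) \<and>
          exp (t * cot t - 1) < cos (2 * t / 3) powr (1 / ln 2) \<and>
          cos (2 * t / 3) powr (1 / ln 2)
            < (2 * sqrt 2 / exp 1) * cos (2 * t / 3) powr (3 / 2)) \<and>
       (\<forall>r::real.
          (\<forall>t::real. 0 < t \<and> t < pi / 2 \<longrightarrow>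
             cos (2 * t / 3) powr r < exp (t * cot t - 1)) \<longrightarrow> r \<ge> 3 / 2) \<and>
       (\<forall>s::real.
          (\<forall>t::real. 0 < t \<and> t < pi / 2 \<longrightarrow>
             exp (t * cot t - 1) < cos (2 * t / 3) powr s) \<longrightarrow> s \<le> 1 / ln 2)) \<and>
      ((\<forall>t::real. 0 < t \<and> t < pi / 2 \<longrightarrow>
          cos (p1 * t) powr (2 / (3 * p1\<^sup>2)) < exp (t * cot t - 1) \<and>
          exp (t * cot t - 1) < cos (p1 * t) powr (1 / p1)) \<and>
       (\<forall>p::real. 0 < p \<and> p < 1 \<longrightarrow>
          (\<forall>t::real. 0 < t \<and> t < pi / 2 \<longrightarrow>
             exp (t * cot t - 1) < cos (p * t) powr (1 / p)) \<longrightarrow> p \<le> p1)))"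
proof -
  have b: "cos (2 * t / 3) powr (3 / 2) < exp (t * cot t - 1) \<and>
      exp (t * cot t - 1) < cos (2 * t / 3) powr (1 / ln 2) \<and>
      cos (2 * t / 3) powr (1 / ln 2) < (2 * sqrt 2 / exp 1) * cos (2 * t / 3) powr (3 / 2)"
    if t: "0 < t" "t < pi / 2" for t :: real
  proof (intro conjI)
    define c where "c = cos (2 * t / 3)"
    have c: "c > 0" using cos_mult_pos[of "2 / 3" t] t by (simp add: c_def)
    \<comment> \<open>At \<open>p = 2/3\<close> the two constants are
      \<open>3 * p\<^sup>2 / 2 = 2/3\<close> and \<open>- ln (cos (pi / 3)) = ln 2\<close>.\<close>
    have l: "1 - t * cot t < 3 / 2 * (- ln c)" "- ln c < ln 2 * (1 - t * cot t)"
      using ln_cos_lower[of "2 / 3" t] ln_cos_upper[of "2 / 3" t] t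
      by (auto simp: c_def power2_eq_square ln_div cos_60)
    show "cos (2 * t / 3) powr (3 / 2) < exp (t * cot t - 1)"
      using l(1) cos_powr_less_iff(1)[OF c] by (simp add: c_def)
    have "1 / ln 2 * (- ln c) < 1 - t * cot t" using l(2) by (simp add: field_simps)
    thus "exp (t * cot t - 1) < cos (2 * t / 3) powr (1 / ln 2)"
      using cos_powr_less_iff(2)[OF c] by (simp add: c_def)
    have "1 / 2 < c"
      using cos_monotone_0_pi[of "2 * t / 3" "pi / 3"] t by (simp add: c_def cos_60)
    hence lc: "- ln 2 < ln c" using ln_less_cancel_iff[of "1 / 2" c] c by (simp add: ln_div)
    \<comment> \<open>No numerics: both constants bound the same quotient strictly, from below and
      above.\<close>
    have "2 / 3 < ln (2::real)"
      using ln_cos_lower[of "2 / 3" t] ln_cos_upper[of "2 / 3" t] x_cot_x_pos[of "2 / 3" t] t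
        mult_less_cancel_right[of "2 / 3" "1 - t * cot t" "ln 2"]
      by (auto simp: power2_eq_square ln_div cos_60)
    hence d: "0 < 3 / 2 - 1 / ln (2::real)" by (simp add: field_simps)
    \<comment> \<open>The third inequality would be an equality at \<open>c = 1/2\<close>; since
      \<open>c\<close> is larger and the exponent difference positive, it is strict.\<close>
    have "- ln 2 * (3 / 2 - 1 / ln 2) < ln c * (3 / 2 - 1 / ln 2)"
      by (rule mult_strict_right_mono[OF lc d])
    moreover have "- ln 2 * (3 / 2 - 1 / ln 2) = 1 - 3 / 2 * ln (2::real)"
      by (simp add: right_diff_distrib)
    ultimately have "1 / ln 2 * ln c < (3 / 2 * ln 2 - 1) + 3 / 2 * ln c"
      by (simp add: right_diff_distrib)
    hence "exp (1 / ln 2 * ln c) < exp (3 / 2 * ln 2 - 1) * exp (3 / 2 * ln c)"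
      by (simp flip: exp_add)
    moreover have "3 / 2 * ln 2 = ln (2 * sqrt (2::real))"
      by (simp add: ln_mult ln_sqrt)
    hence "exp (3 / 2 * ln 2) = 2 * sqrt (2::real)" by simp
    ultimately show "cos (2 * t / 3) powr (1 / ln 2) < (2 * sqrt 2 / exp 1) * cos (2 * t / 3) powr (3 / 2)"
      using c by (simp add: c_def[symmetric] powr_def exp_diff)
  qed
  have best_r: "r \<ge> 3 / 2"
    if "\<forall>t::real. 0 < t \<and> t < pi / 2 \<longrightarrow> cos (2 * t / 3) powr r < exp (t * cot t - 1)" for r :: real
    using lower_exponent_bound[of "2 / 3" r] that by (simp add: power2_eq_square)
  have best_s: "s \<le> 1 / ln 2"
    if "\<forall>t::real. 0 < t \<and> t < pi / 2 \<longrightarrow> exp (t * cot t - 1) < cos (2 * t / 3) powr s" for s :: real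
    using upper_exponent_bound[of "2 / 3" s] that by (simp add: cos_60 ln_div field_simps)
  have best_low: "p \<ge> 2 / 3"
    if "0 < p" "p < 1"
      "\<forall>t::real. 0 < t \<and> t < pi / 2 \<longrightarrow> cos (p * t) powr (1 / p) < exp (t * cot t - 1)" for p :: real
    using lower_exponent_bound[of p "1 / p"] that by (simp add: power2_eq_square field_simps)
  have root: "(0.6505 \<le> p1 \<and> p1 < 0.6506) \<and>
      (\<forall>t::real. 0 < t \<and> t < pi / 2 \<longrightarrow>
          cos (p1 * t) powr (2 / (3 * p1\<^sup>2)) < exp (t * cot t - 1) \<and>
          exp (t * cot t - 1) < cos (p1 * t) powr (1 / p1)) \<and>
      (\<forall>p::real. 0 < p \<and> p < 1 \<longrightarrow>
          (\<forall>t::real. 0 < t \<and> t < pi / 2 \<longrightarrow>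
             exp (t * cot t - 1) < cos (p * t) powr (1 / p)) \<longrightarrow> p \<le> p1)"
    if "0 < p1 \<and> p1 < 1 \<and> 1 + (1 / p1) * ln (cos (p1 * pi / 2)) = 0" for p1 :: real
  proof -
    have p1: "0 < p1" "p1 < 1" "- ln (cos (p1 * pi / 2)) = p1"
      using that root_equation_iff[of p1] by auto
    have "0.6505 \<le> p1"
      using root_sign_after[of p1 "0.6505"] root_lower p1 by force
    \<comment> \<open>Equality is split off because \<open>root_sign_after\<close> needs strictly
      ordered points; it contradicts \<open>root_upper\<close> directly.\<close>
    moreover have "p1 < 0.6506"
      using root_sign_after[of "0.6506" p1] root_upper p1 by (cases "p1 = 0.6506") force+
    moreover have "cos (p1 * t) powr (2 / (3 * p1\<^sup>2)) < exp (t * cot t - 1)"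
        "exp (t * cot t - 1) < cos (p1 * t) powr (1 / p1)"
      if t: "0 < t" "t < pi / 2" for t
    proof -
      have c: "cos (p1 * t) > 0" using cos_mult_pos[of p1 t] p1 t by simp
      have "9 / 14 < p1" using \<open>0.6505 \<le> p1\<close> by simp
      note l = ln_cos_lower[OF this p1(2) t] ln_cos_upper[OF this p1(2) t]
      have "1 - t * cot t < 2 / (3 * p1\<^sup>2) * (- ln (cos (p1 * t)))"
        using l(1) p1(1) by (simp add: field_simps)
      thus "cos (p1 * t) powr (2 / (3 * p1\<^sup>2)) < exp (t * cot t - 1)"
        by (simp add: cos_powr_less_iff(1)[OF c])
      \<comment> \<open>The root equation turns the upper constant
        \<open>- ln (cos (p1 * pi / 2))\<close> into \<open>p1\<close> itself.\<close>
      have "1 / p1 * (- ln (cos (p1 * t))) < 1 - t * cot t"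
        using l(2) p1(1) unfolding p1(3) by (simp add: field_simps)
      thus "exp (t * cot t - 1) < cos (p1 * t) powr (1 / p1)"
        by (simp add: cos_powr_less_iff(2)[OF c])
    qed
    moreover have "p \<le> p1"
      if p: "0 < p" "p < 1" and
        "\<forall>t::real. 0 < t \<and> t < pi / 2 \<longrightarrow> exp (t * cot t - 1) < cos (p * t) powr (1 / p)" for p
    proof -
      have "1 / p * (- ln (cos (p * pi / 2))) \<le> 1"
        using upper_exponent_bound[of p "1 / p"] that by simp
      hence "p + ln (cos (p * pi / 2)) \<ge> 0" using p by (simp add: field_simps)
      \<comment> \<open>Any \<open>p\<close> beyond the root would make this expression
        negative.\<close>
      thus ?thesis using root_sign_after[of p1 p] p p1 by force
    qed
    ultimately show ?thesis by blast
  qed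
  show ?thesis
  proof (rule conjI[OF ex1_root], intro allI impI)
    fix p1 :: real
    assume "0 < p1 \<and> p1 < 1 \<and> 1 + (1 / p1) * ln (cos (p1 * pi / 2)) = 0"
    note r = root[OF this]
    have rt: "cos (p1 * t) powr (2 / (3 * p1\<^sup>2)) < exp (t * cot t - 1)"
        "exp (t * cot t - 1) < cos (p1 * t) powr (1 / p1)" if "0 < t" "t < pi / 2" for t
      using r[THEN conjunct2, THEN conjunct1, rule_format, of t] that by simp_all
    note rp = r[THEN conjunct2, THEN conjunct2, rule_format]
    show "(0.6505 \<le> p1 \<and> p1 < 0.6506) \<and>
      ((\<forall>t::real. 0 < t \<and> t < pi / 2 \<longrightarrow>
          cos (2 * t / 3) powr (3 / 2) < exp (t * cot t - 1) \<and>
          exp (t * cot t - 1) < cos (p1 * t) powr (1 / p1)) \<and>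
       (\<forall>p::real. 0 < p \<and> p < 1 \<longrightarrow>
          (\<forall>t::real. 0 < t \<and> t < pi / 2 \<longrightarrow>
             cos (p * t) powr (1 / p) < exp (t * cot t - 1)) \<longrightarrow> p \<ge> 2 / 3) \<and>
       (\<forall>p::real. 0 < p \<and> p < 1 \<longrightarrow>
          (\<forall>t::real. 0 < t \<and> t < pi / 2 \<longrightarrow>
             exp (t * cot t - 1) < cos (p * t) powr (1 / p)) \<longrightarrow> p \<le> p1)) \<and>
      ((\<forall>t::real. 0 < t \<and> t < pi / 2 \<longrightarrow>
          cos (2 * t / 3) powr (3 / 2) < exp (t * cot t - 1) \<and>
          exp (t * cot t - 1) < cos (2 * t / 3) powr (1 / ln 2) \<and>
          cos (2 * t / 3) powr (1 / ln 2)
            < (2 * sqrt 2 / exp 1) * cos (2 * t / 3) powr (3 / 2)) \<and>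
       (\<forall>r::real.
          (\<forall>t::real. 0 < t \<and> t < pi / 2 \<longrightarrow>
             cos (2 * t / 3) powr r < exp (t * cot t - 1)) \<longrightarrow> r \<ge> 3 / 2) \<and>
       (\<forall>s::real.
          (\<forall>t::real. 0 < t \<and> t < pi / 2 \<longrightarrow>
             exp (t * cot t - 1) < cos (2 * t / 3) powr s) \<longrightarrow> s \<le> 1 / ln 2)) \<and>
      ((\<forall>t::real. 0 < t \<and> t < pi / 2 \<longrightarrow>
          cos (p1 * t) powr (2 / (3 * p1\<^sup>2)) < exp (t * cot t - 1) \<and>
          exp (t * cot t - 1) < cos (p1 * t) powr (1 / p1)) \<and>
       (\<forall>p::real. 0 < p \<and> p < 1 \<longrightarrow>
          (\<forall>t::real. 0 < t \<and> t < pi / 2 \<longrightarrow>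
             exp (t * cot t - 1) < cos (p * t) powr (1 / p)) \<longrightarrow> p \<le> p1))"
      by (intro conjI allI impI)
         (rule r[THEN conjunct1, THEN conjunct1] r[THEN conjunct1, THEN conjunct2] rt
               b[THEN conjunct1] b[THEN conjunct2, THEN conjunct1] b[THEN conjunct2, THEN conjunct2]
               best_low best_r best_s rp; simp)+
  qed
qed

end
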